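(* For every $n\geq0$, the number of Dumont permutations of the second kind in $S_n$ avoiding $321$, the number of Dumont permutations (of the first kind) in $S_n$ avoiding $231$, and the number of Dumont permutations (of the first kind) in $S_n$ avoiding $312$ are all equal to the Catalan number $C_{\lfloor n/2\rfloor}$.
   Context: A permutation $\pi=\pi_1\cdots\pi_n\in S_n$ is a Dumont permutation of the first kind if every even entry $\pi_i$ is followed by a smaller entry ($i<n$ and $\pi_{i+1}<\pi_i$) and every odd entry $\pi_i$ is either last ($i=n$) or followed by a larger entry. It is a Dumont permutation of the second kind if $\pi_i<i$ for every even position $i$ and $\pi_i\geq i$ for every odd position $i$. The empty permutation is counted in both classes. $\pi$ avoids a (classical) pattern $\tau\in S_3$ if no subsequence of $\pi$ of length $3$ is order-isomorphic to $\tau$. $C_m=\frac1{m+1}\binom{2m}{m}$. *)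

theory Defs
  imports
    Complex_Main
    "HOL-Library.Sublist"
    "HOL-Combinatorics.Multiset_Permutations"
begin

text \<open>
  A permutation in $S_n$ is represented by its one-line notation, an element of
  \<^term>\<open>permutations_of_set {1..n::nat}\<close>. List positions count from 0, so
  the entry $\pi_i$ is \<open>xs ! (i - 1)\<close>.
\<close>

definition dumont_first :: "nat list \<Rightarrow> bool" where
  "dumont_first xs \<longleftrightarrow>
     (\<forall>i\<in>{1..length xs}.
        (even (xs ! (i - 1)) \<longrightarrow> i < length xs \<and> xs ! i < xs ! (i - 1)) \<and>
        (odd (xs ! (i - 1)) \<longrightarrow> i = length xs \<or> xs ! i > xs ! (i - 1)))"

definition dumont_second :: "nat list \<Rightarrow> bool" where
  "dumont_second xs \<longleftrightarrow>
     (\<forall>i\<in>{1..length xs}.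
        (even i \<longrightarrow> xs ! (i - 1) < i) \<and>
        (odd i \<longrightarrow> xs ! (i - 1) \<ge> i))"

definition order_isomorphic :: "nat list \<Rightarrow> nat list \<Rightarrow> bool" where
  "order_isomorphic xs ys \<longleftrightarrow>
     length xs = length ys \<and>
     (\<forall>i<length xs. \<forall>j<length xs. xs ! i < xs ! j \<longleftrightarrow> ys ! i < ys ! j)"

definition avoids :: "nat list \<Rightarrow> nat list \<Rightarrow> bool" where
  "avoids xs pat \<longleftrightarrow> \<not> (\<exists>s. subseq s xs \<and> order_isomorphic s pat)"

definition catalan :: "nat \<Rightarrow> real" where
  "catalan m = 1 / (real m + 1) * real ((2 * m) choose m)"

end

theory Submission
  imports Defs
begin

text \<open>
  Second kind, 321: the entries at odd positions are weak excedances and those at even positions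
  deficiencies, so 321-avoidance means that both subsequences increase. The permutation is then
  determined by the set of values at even positions, and the Dumont inequalities say that this
  set encodes a ballot sequence.

  First kind, 231: all entries left of the maximum are smaller than all entries right of it, so the
  permutation splits into two blocks on consecutive intervals. A block starting with an even
  value must be empty, since its minimum would have to be followed by a smaller entry; this leaves
  the Catalan recurrence.

  First kind, 312: the same splitting happens at the minimum. The left block is now followed by
  a smaller entry instead of a larger one, so the recurrence involves a second class of
  permutations, which satisfies the Catalan recurrence on its own.
\<close>

subsection \<open>The Catalan convolution\<close>

lemma catalan_0 [simp]: "catalan 0 = 1"
  by (simp add: catalan_def)

text \<open>The ratio of consecutive Catalan numbers without denominators. Two absorption identities
  pass from one central binomial coefficient to the next through
  \<open>(2 * m + 1) choose m\<close>.\<close>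

lemma catalan_Suc: "(real m + 2) * catalan (Suc m) = (4 * real m + 2) * catalan m"
proof -
  have "Suc m * ((2 * Suc m) choose Suc m) = 2 * (2 * m + 1) * ((2 * m) choose m)"
  proof -
    have 1: "Suc m * ((2 * Suc m) choose Suc m) = (2 * Suc m) * ((2 * m + 1) choose m)"
      using Suc_times_binomial_eq[of "2*m+1" m] by (simp add: mult.commute)
    have 2: "(Suc m) * ((2 * m + 1) choose m) = (2 * m + 1) * ((2 * m) choose m)"
      using binomial_absorb_comp[of "2*m+1" m] by simp
    have "Suc m * ((2 * Suc m) choose Suc m) = 2 * (Suc m * ((2 * m + 1) choose m))"
      using 1 by simp
    then show ?thesis using 2 by simp
  qed
  then have "real (Suc m * ((2 * Suc m) choose Suc m)) = real (2 * (2 * m + 1) * ((2 * m) choose m))"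
    by (simp only:)
  then have "(real m + 1) * real ((2 * Suc m) choose Suc m) = (4 * real m + 2) * real ((2 * m) choose m)"
    by (simp add: algebra_simps)
  moreover have "(real m + 2) * catalan (Suc m) = real ((2 * Suc m) choose Suc m)"
    unfolding catalan_def by (simp add: field_simps)
  moreover have "(real m + 1) * catalan m = real ((2 * m) choose m)"
    unfolding catalan_def by (simp add: field_simps)
  ultimately have "(real m + 1) * ((real m + 2) * catalan (Suc m)) =
      (real m + 1) * ((4 * real m + 2) * catalan m)"
    by (metis mult.left_commute)
  then show ?thesis
    by (smt (verit, best) mult_cancel_left of_nat_0_le_iff)
qed

text \<open>
  Writing $S_m$ for the convolution, reflecting $i \mapsto m - i$ gives
  $\sum (i + 1) C_i C_{m-i} = (m/2 + 1) S_m$, while peeling off $i = 0$ and using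
  $(i + 2) C_{i+1} = (4 i + 2) C_i$ gives $C_m + 2 m S_{m-1}$ for the same sum.
\<close>

lemma catalan_convolution:
  "(\<Sum>i\<le>m. catalan i * catalan (m - i)) = catalan (Suc m)"
proof (induction m)
  case 0
  show ?case using catalan_Suc[of 0] by simp
next
  case (Suc m)
  have sym: "2 * (\<Sum>i\<le>n. real i * (catalan i * catalan (n - i))) =
      real n * (\<Sum>i\<le>n. catalan i * catalan (n - i))" for n
  proof -
    have "(\<Sum>i\<le>n. real i * (catalan i * catalan (n - i))) =
        (\<Sum>i\<le>n. real (n - i) * (catalan i * catalan (n - i)))"
      by (rule sum.reindex_bij_witness[of _ "\<lambda>i. n - i" "\<lambda>i. n - i"]) auto
    then have "2 * (\<Sum>i\<le>n. real i * (catalan i * catalan (n - i))) =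
        (\<Sum>i\<le>n. real i * (catalan i * catalan (n - i)) + real (n - i) * (catalan i * catalan (n - i)))"
      by (simp add: sum.distrib)
    also have "\<dots> = (\<Sum>i\<le>n. real n * (catalan i * catalan (n - i)))"
      by (rule sum.cong) (auto simp: of_nat_diff algebra_simps)
    finally show ?thesis by (simp add: sum_distrib_left)
  qed
  let ?S = "\<Sum>i\<le>Suc m. catalan i * catalan (Suc m - i)"
  have "(\<Sum>i\<le>Suc m. (real i + 1) * catalan i * catalan (Suc m - i)) =
      catalan (Suc m) + (\<Sum>i\<le>m. (real i + 2) * catalan (Suc i) * catalan (m - i))"
    by (subst sum.atMost_Suc_shift) (simp add: algebra_simps)
  also have "(\<Sum>i\<le>m. (real i + 2) * catalan (Suc i) * catalan (m - i)) =
      (\<Sum>i\<le>m. 4 * (real i * (catalan i * catalan (m - i))) + 2 * (catalan i * catalan (m - i)))"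
  proof (rule sum.cong)
    fix i
    show "(real i + 2) * catalan (Suc i) * catalan (m - i) =
        4 * (real i * (catalan i * catalan (m - i))) + 2 * (catalan i * catalan (m - i))"
      by (subst catalan_Suc) (simp add: algebra_simps)
  qed simp
  also have "\<dots> = 2 * (2 * (\<Sum>i\<le>m. real i * (catalan i * catalan (m - i)))) + 2 * catalan (Suc m)"
    using Suc by (simp add: sum.distrib sum_distrib_left[symmetric])
  also have "\<dots> = (2 * real m + 2) * catalan (Suc m)"
    by (subst sym, subst Suc) (simp add: algebra_simps)
  finally have "(\<Sum>i\<le>Suc m. (real i + 1) * catalan i * catalan (Suc m - i)) =
      (2 * real m + 3) * catalan (Suc m)"
    by (simp add: algebra_simps)
  moreover have "(\<Sum>i\<le>Suc m. (real i + 1) * catalan i * catalan (Suc m - i)) =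
      (\<Sum>i\<le>Suc m. real i * (catalan i * catalan (Suc m - i))) + ?S"
    by (subst sum.distrib[symmetric], rule sum.cong) (simp_all add: algebra_simps)
  \<comment> \<open>Equating the two evaluations and doubling gives
    \<open>(m + 3) * ?S = (4 * m + 6) * catalan (Suc m)\<close>, and the ratio identity rewrites the
    right side.\<close>
  ultimately have "(real (Suc m) + 2) * ?S = (real (Suc m) + 2) * catalan (Suc (Suc m))"
    using sym[of "Suc m"] catalan_Suc[of "Suc m"] by (simp add: algebra_simps)
  then show ?case
    by (simp only: mult_cancel_left) linarith
qed

text \<open>Meant for the recurrences below: they sum over all cut points, but offsets of one parity
  contribute nothing, and the halved offsets index a Catalan convolution.\<close>

lemma sum_even_offsets:
  fixes g :: "nat \<Rightarrow> real"
  shows "(\<Sum>j<n. if even j then g (j div 2) else 0) = (\<Sum>i<(n + 1) div 2. g i)"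
proof (induction n)
  case (Suc n)
  show ?case
  proof (cases "even n")
    case True
    then have "(Suc n + 1) div 2 = Suc (n div 2)" "(n + 1) div 2 = n div 2"
      by presburger+
    with True Suc show ?thesis by simp
  next
    case False
    then have "(Suc n + 1) div 2 = (n + 1) div 2" by presburger
    with False Suc show ?thesis by simp
  qed
qed simp

subsection \<open>Avoiding a pattern of length three\<close>

lemma ball_atLeast1_atMost_iff:
  fixes n :: nat
  shows "(\<forall>i\<in>{1..n}. P i) \<longleftrightarrow> (\<forall>i<n. P (Suc i))"
  by (metis Suc_le_eq Suc_pred atLeastAtMost_iff less_eq_Suc_le zero_less_Suc One_nat_def)

lemma order_isomorphic_length_3:
  "order_isomorphic s [a, b, c] \<longleftrightarrow> (\<exists>x y z. s = [x, y, z] \<and>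
     (x < y \<longleftrightarrow> a < b) \<and> (y < x \<longleftrightarrow> b < a) \<and> (x < z \<longleftrightarrow> a < c) \<and>
     (z < x \<longleftrightarrow> c < a) \<and> (y < z \<longleftrightarrow> b < c) \<and> (z < y \<longleftrightarrow> c < b))"
proof (cases "length s = 3")
  case True
  then obtain x y z where "s = [x, y, z]"
    by (auto simp: numeral_3_eq_3 length_Suc_conv)
  then show ?thesis
    by (simp add: order_isomorphic_def All_less_Suc) blast
qed (auto simp: order_isomorphic_def)

lemma avoids_length_3_iff:
  "avoids xs [a, b, c] \<longleftrightarrow>
    (\<forall>x y z. subseq [x, y, z] xs \<longrightarrow> \<not> order_isomorphic [x, y, z] [a, b, c])"
proof -
  have "\<exists>x y z. s = [x, y, z]" if "order_isomorphic s [a, b, c]" for s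
    using that unfolding order_isomorphic_length_3 by blast
  then show ?thesis
    unfolding avoids_def by metis
qed

lemma avoids_231_iff:
  "avoids xs [2, 3, 1] \<longleftrightarrow> (\<forall>x y z. subseq [x, y, z] xs \<longrightarrow> z < x \<longrightarrow> \<not> x < y)"
proof -
  have "order_isomorphic [x, y, z] [2, 3, 1] \<longleftrightarrow> z < x \<and> x < y" for x y z
    by (auto simp: order_isomorphic_length_3)
  then show ?thesis
    unfolding avoids_length_3_iff by simp
qed

lemma avoids_312_iff:
  "avoids xs [3, 1, 2] \<longleftrightarrow> (\<forall>x y z. subseq [x, y, z] xs \<longrightarrow> z < x \<longrightarrow> \<not> y < z)"
proof -
  have "order_isomorphic [x, y, z] [3, 1, 2] \<longleftrightarrow> z < x \<and> y < z" for x y z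
    by (auto simp: order_isomorphic_length_3)
  then show ?thesis
    unfolding avoids_length_3_iff by simp
qed

lemma avoids_321_iff:
  "avoids xs [3, 2, 1] \<longleftrightarrow> (\<forall>x y z. subseq [x, y, z] xs \<longrightarrow> y < x \<longrightarrow> \<not> z < y)"
proof -
  have "order_isomorphic [x, y, z] [3, 2, 1] \<longleftrightarrow> y < x \<and> z < y" for x y z
    by (auto simp: order_isomorphic_length_3)
  then show ?thesis
    unfolding avoids_length_3_iff by simp
qed

lemma avoids_subseq: "avoids xs pat \<Longrightarrow> subseq ys xs \<Longrightarrow> avoids ys pat"
  unfolding avoids_def using subseq_order.order_trans[of _ ys xs] by blast

section \<open>Cutting 231- and 312-avoiders at an extreme entry\<close>

lemma append_eq_length_3_cases:
  assumes "[x, y, z] = us @ vs"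
  obtains "us = []" "vs = [x, y, z]" | "us = [x]" "vs = [y, z]"
  | "us = [x, y]" "vs = [z]" | "us = [x, y, z]" "vs = []"
proof -
  have "us = [] \<and> vs = [x, y, z] \<or> us = [x] \<and> vs = [y, z] \<or> us = [x, y] \<and> vs = [z] \<or>
      us = [x, y, z] \<and> vs = []"
    using assms by (auto simp: Cons_eq_append_conv)
  then show thesis using that by blast
qed

lemma avoids_231D:
  "avoids xs [2, 3, 1] \<Longrightarrow> subseq [x, y, z] xs \<Longrightarrow> z < x \<Longrightarrow> \<not> x < y"
  unfolding avoids_231_iff by blast

text \<open>The maximum can only serve as the 3. Entries \<open>y < x\<close> with \<open>x\<close>
  left and \<open>y\<close> right of \<open>m\<close> complete \<open>x, m, y\<close>. Conversely,
  an occurrence not confined to one block has its 2 on the left and its 1 on the right, against the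
  order of the blocks.\<close>

lemma avoids_231_split_max_iff:
  assumes "\<forall>x\<in>set xs \<union> set ys. x < m" and "distinct (xs @ ys)"
  shows "avoids (xs @ m # ys) [2, 3, 1] \<longleftrightarrow>
    avoids xs [2, 3, 1] \<and> avoids ys [2, 3, 1] \<and> (\<forall>x\<in>set xs. \<forall>y\<in>set ys. x < y)"
proof (intro iffI conjI ballI)
  assume *: "avoids (xs @ m # ys) [2, 3, 1]"
  show "avoids xs [2, 3, 1]" "avoids ys [2, 3, 1]"
    using avoids_subseq[OF *] by (auto intro: subseq_rev_drop_many subseq_drop_many)
  fix x y assume xy: "x \<in> set xs" "y \<in> set ys"
  then have "subseq ([x] @ [m, y]) (xs @ m # ys)"
    by (intro list_emb_append_mono) (auto simp: subseq_singleton_left)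
  with avoids_231D[OF *, of x m y] xy assms(1) have "\<not> y < x"
    by auto
  with xy assms(2) show "x < y"
    by (metis disjoint_iff distinct_append linorder_neqE_nat)
next
  assume *: "avoids xs [2, 3, 1] \<and> avoids ys [2, 3, 1] \<and> (\<forall>x\<in>set xs. \<forall>y\<in>set ys. x < y)"
  show "avoids (xs @ m # ys) [2, 3, 1]"
    unfolding avoids_231_iff
  proof (intro allI impI notI)
    fix x y z assume s: "subseq [x, y, z] (xs @ m # ys)" and "z < x" "x < y"
    from s obtain us vs where uv: "[x, y, z] = us @ vs" "subseq us xs" "subseq vs (m # ys)"
      by (rule subseq_appendE)
    have sub: "set us \<subseteq> set xs" "set vs \<subseteq> insert m (set ys)"
      using uv(2,3) by (blast elim: list_emb_set, force elim: list_emb_set)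
    have le: "\<forall>u\<in>set us. u < m" "\<forall>v\<in>set vs. v \<le> m"
      using sub assms(1) by (auto simp: less_imp_le)
    from uv(1) show False
    proof (cases rule: append_eq_length_3_cases)
      case 1
      with le \<open>z < x\<close> \<open>x < y\<close> have "x \<noteq> m"
        by auto
      with 1 uv have "subseq [x, y, z] ys"
        by (auto dest: subseq_Cons2_neq)
      with * \<open>z < x\<close> \<open>x < y\<close> show False
        using avoids_231D by blast
    next
      case 2
      with sub le \<open>z < x\<close> \<open>x < y\<close> have "x \<in> set xs" "z \<in> set ys"
        by auto
      with * \<open>z < x\<close> show False
        by (metis less_asym)
    next
      case 3
      with sub le \<open>z < x\<close> \<open>x < y\<close> have "x \<in> set xs" "z \<in> set ys"
        by auto
      with * \<open>z < x\<close> show False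
        by (metis less_asym)
    next
      case 4
      with uv have "subseq [x, y, z] xs"
        by simp
      with * \<open>z < x\<close> \<open>x < y\<close> show False
        using avoids_231D by blast
    qed
  qed
qed

lemma avoids_312D:
  "avoids xs [3, 1, 2] \<Longrightarrow> subseq [x, y, z] xs \<Longrightarrow> z < x \<Longrightarrow> \<not> y < z"
  unfolding avoids_312_iff by blast

text \<open>The mirror image under reverse-complement, which exchanges 231 with 312 and maximum with
  minimum: \<open>m\<close> can only serve as the 1, and a straddling occurrence has its 3 on the
  left and its 2 on the right.\<close>

lemma avoids_312_split_min_iff:
  assumes "\<forall>x\<in>set xs \<union> set ys. m < x" and "distinct (xs @ ys)"
  shows "avoids (xs @ m # ys) [3, 1, 2] \<longleftrightarrow>
    avoids xs [3, 1, 2] \<and> avoids ys [3, 1, 2] \<and> (\<forall>x\<in>set xs. \<forall>y\<in>set ys. x < y)"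
proof (intro iffI conjI ballI)
  assume *: "avoids (xs @ m # ys) [3, 1, 2]"
  show "avoids xs [3, 1, 2]" "avoids ys [3, 1, 2]"
    using avoids_subseq[OF *] by (auto intro: subseq_rev_drop_many subseq_drop_many)
  fix x y assume xy: "x \<in> set xs" "y \<in> set ys"
  then have "subseq ([x] @ [m, y]) (xs @ m # ys)"
    by (intro list_emb_append_mono) (auto simp: subseq_singleton_left)
  with avoids_312D[OF *, of x m y] xy assms(1) have "\<not> y < x"
    by auto
  with xy assms(2) show "x < y"
    by (metis disjoint_iff distinct_append linorder_neqE_nat)
next
  assume *: "avoids xs [3, 1, 2] \<and> avoids ys [3, 1, 2] \<and> (\<forall>x\<in>set xs. \<forall>y\<in>set ys. x < y)"
  show "avoids (xs @ m # ys) [3, 1, 2]"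
    unfolding avoids_312_iff
  proof (intro allI impI notI)
    fix x y z assume s: "subseq [x, y, z] (xs @ m # ys)" and "z < x" "y < z"
    from s obtain us vs where uv: "[x, y, z] = us @ vs" "subseq us xs" "subseq vs (m # ys)"
      by (rule subseq_appendE)
    have sub: "set us \<subseteq> set xs" "set vs \<subseteq> insert m (set ys)"
      using uv(2,3) by (blast elim: list_emb_set, force elim: list_emb_set)
    have le: "\<forall>u\<in>set us. m < u" "\<forall>v\<in>set vs. m \<le> v"
      using sub assms(1) by (auto simp: less_imp_le)
    from uv(1) show False
    proof (cases rule: append_eq_length_3_cases)
      case 1
      with le \<open>z < x\<close> \<open>y < z\<close> have "x \<noteq> m"
        by auto
      with 1 uv have "subseq [x, y, z] ys"
        by (auto dest: subseq_Cons2_neq)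
      with * \<open>z < x\<close> \<open>y < z\<close> show False
        using avoids_312D by blast
    next
      case 2
      with sub le \<open>z < x\<close> \<open>y < z\<close> have "x \<in> set xs" "z \<in> set ys"
        by auto
      with * \<open>z < x\<close> show False
        by (metis less_asym)
    next
      case 3
      with sub le \<open>z < x\<close> \<open>y < z\<close> have "x \<in> set xs" "z \<in> set ys"
        by auto
      with * \<open>z < x\<close> show False
        by (metis less_asym)
    next
      case 4
      with uv have "subseq [x, y, z] xs"
        by simp
      with * \<open>z < x\<close> \<open>y < z\<close> show False
        using avoids_312D by blast
    qed
  qed
qed

subsection \<open>Dumont permutations of the first kind\<close>

text \<open>
  The flag says how the list continues: it is true if the last entry counts as followed by a
  smaller entry, and false if it counts as followed by a larger one. Both occur for the
  blocks of a Dumont permutation that is cut at its minimum or maximum.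
\<close>

fun parity_descents :: "bool \<Rightarrow> nat list \<Rightarrow> bool" where
  "parity_descents c [] = True"
| "parity_descents c [x] = (even x = c)"
| "parity_descents c (x # y # xs) = (even x = (y < x) \<and> parity_descents c (y # xs))"

lemma parity_descents_nth:
  "parity_descents c xs \<longleftrightarrow>
    (\<forall>i<length xs. even (xs ! i) = (if Suc i = length xs then c else xs ! Suc i < xs ! i))"
  by (induction c xs rule: parity_descents.induct) (simp_all add: All_less_Suc2 del: all_simps)

text \<open>Distinctness excludes equal neighbours, so "not followed by a smaller entry" means
  "followed by a larger one". The flag is \<open>False\<close> because the last entry of a Dumont
  permutation must be odd.\<close>

lemma dumont_first_iff_parity_descents:
  assumes "distinct xs"
  shows "dumont_first xs \<longleftrightarrow> parity_descents False xs"
proof -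
  have "xs ! i \<noteq> xs ! Suc i" if "Suc i < length xs" for i
    using that assms by (simp add: nth_eq_iff_index_eq)
  then have "(even (xs ! i) \<longrightarrow> Suc i < length xs \<and> xs ! Suc i < xs ! i) \<and>
      (odd (xs ! i) \<longrightarrow> Suc i = length xs \<or> xs ! Suc i > xs ! i) \<longleftrightarrow>
      even (xs ! i) = (if Suc i = length xs then False else xs ! Suc i < xs ! i)"
    if "i < length xs" for i
    using that by (cases "Suc i = length xs") (force simp: nat_neq_iff)+
  then show ?thesis
    unfolding dumont_first_def parity_descents_nth ball_atLeast1_atMost_iff by simp
qed

text \<open>The last entry of \<open>xs\<close> is followed by the larger \<open>m\<close>, which is
  what the flag \<open>False\<close> records; at a minimum, below, the flag becomes
  \<open>True\<close>. The block after the cut inherits \<open>c\<close>.\<close>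

lemma parity_descents_append_larger:
  assumes "\<forall>x\<in>set xs. x < m"
  shows "parity_descents c (xs @ m # ys) \<longleftrightarrow> parity_descents False xs \<and> parity_descents c (m # ys)"
  using assms by (induction False xs rule: parity_descents.induct) auto

lemma parity_descents_append_smaller:
  assumes "\<forall>x\<in>set xs. m < x"
  shows "parity_descents c (xs @ m # ys) \<longleftrightarrow> parity_descents True xs \<and> parity_descents c (m # ys)"
  using assms by (induction True xs rule: parity_descents.induct) auto

text \<open>Whatever follows a maximum is smaller; only if nothing follows does the flag decide. For
  a minimum, a descent is left only in that last case.\<close>

lemma parity_descents_Cons_max:
  assumes "\<forall>y\<in>set ys. y < m"
  shows "parity_descents c (m # ys) \<longleftrightarrow> even m = (ys \<noteq> [] \<or> c) \<and> parity_descents c ys"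
  using assms by (cases ys) auto

lemma parity_descents_Cons_min:
  assumes "\<forall>y\<in>set ys. m < y"
  shows "parity_descents c (m # ys) \<longleftrightarrow> even m = (ys = [] \<and> c) \<and> parity_descents c ys"
  using assms by (cases ys) auto

text \<open>Turns the block order supplied by avoidance into one cut point, so that both blocks are
  intervals again and the recursion closes. The cut is \<open>Min B\<close>, or \<open>b\<close> if
  \<open>B\<close> is empty.\<close>

lemma interval_split:
  fixes a b :: nat
  assumes "A \<union> B = {a..<b}" "\<forall>x\<in>A. \<forall>y\<in>B. x < y" "a \<le> b"
  obtains k where "k \<in> {a..b}" "A = {a..<k}" "B = {k..<b}"
proof (cases "B = {}")
  case True
  with assms that[of b] show ?thesis by auto
next
  case False
  have fin: "finite B" using assms(1) by (metis finite_Un finite_atLeastLessThan)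
  have k: "Min B \<in> B" "\<And>y. y \<in> B \<Longrightarrow> Min B \<le> y" using False fin by auto
  then have "Min B \<in> {a..<b}" using assms(1) by blast
  moreover have "x \<in> A \<longleftrightarrow> a \<le> x \<and> x < Min B" "x \<in> B \<longleftrightarrow> Min B \<le> x \<and> x < b" for x
  proof -
    have "x \<in> A \<or> x \<in> B \<longleftrightarrow> a \<le> x \<and> x < b"
      using assms(1) by (metis Un_iff atLeastLessThan_iff)
    moreover have "x \<in> A \<Longrightarrow> x < Min B"
      using assms(2) k(1) by blast
    ultimately show "x \<in> A \<longleftrightarrow> a \<le> x \<and> x < Min B" "x \<in> B \<longleftrightarrow> Min B \<le> x \<and> x < b"
      using k(2)[of x] \<open>Min B \<in> {a..<b}\<close> by auto
  qed
  then have "A = {a..<Min B}" "B = {Min B..<b}"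
    by (simp_all add: set_eq_iff)
  ultimately show ?thesis using that[of "Min B"] by auto
qed

text \<open>Gluing is injective: \<open>m\<close> lies in neither block, so its place in the list
  determines both, and \<open>f\<close> recovers the cut from the left block alone.\<close>

lemma card_image_split:
  assumes "finite K" "\<And>k. k \<in> K \<Longrightarrow> finite (A k)" "\<And>k. k \<in> K \<Longrightarrow> finite (B k)"
    and "\<And>k xs. k \<in> K \<Longrightarrow> xs \<in> A k \<Longrightarrow> m \<notin> set xs \<and> k = f xs"
    and "\<And>k ys. k \<in> K \<Longrightarrow> ys \<in> B k \<Longrightarrow> m \<notin> set ys"
  shows "card ((\<lambda>(k, xs, ys). xs @ m # ys) ` (SIGMA k:K. A k \<times> B k)) =
    (\<Sum>k\<in>K. card (A k) * card (B k))"
proof -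
  have "inj_on (\<lambda>(k, xs, ys). xs @ m # ys) (SIGMA k:K. A k \<times> B k)"
  proof (rule inj_onI, clarsimp)
    fix k xs ys k' xs' ys'
    assume *: "k \<in> K" "xs \<in> A k" "ys \<in> B k" "k' \<in> K" "xs' \<in> A k'" "ys' \<in> B k'"
      "xs @ m # ys = xs' @ m # ys'"
    have "xs = xs' \<and> ys = ys'"
      using append_Cons_eq_iff[of m xs ys xs' ys'] assms(4,5) * by blast
    then show "k = k' \<and> xs = xs' \<and> ys = ys'"
      using assms(4) * by metis
  qed
  then show ?thesis
    using assms(1-3) by (simp add: card_image card_SigmaI card_cartesian_product)
qed

text \<open>
  Permutations of arbitrary intervals, so that the blocks need no renumbering, which would
  change parities.
\<close>

definition parity_avoiders :: "nat list \<Rightarrow> bool \<Rightarrow> nat \<Rightarrow> nat \<Rightarrow> nat list set" where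
  "parity_avoiders pat c a b =
     {p \<in> permutations_of_set {a..<b}. parity_descents c p \<and> avoids p pat}"

section \<open>Recurrences for permutations of an interval\<close>

lemma finite_parity_avoiders [simp]: "finite (parity_avoiders pat c a b)"
  by (simp add: parity_avoiders_def)

lemma in_parity_avoiders_iff:
  "p \<in> parity_avoiders pat c a b \<longleftrightarrow>
     set p = {a..<b} \<and> distinct p \<and> parity_descents c p \<and> avoids p pat"
  by (auto simp: parity_avoiders_def permutations_of_set_def)

lemma length_parity_avoiders: "p \<in> parity_avoiders pat c a b \<Longrightarrow> length p = b - a"
  by (metis in_parity_avoiders_iff card_atLeastLessThan distinct_card)

lemma parity_avoiders_refl [simp]:
  assumes "pat \<noteq> []" shows "parity_avoiders pat c a a = {[]}"
  using assms by (auto simp: in_parity_avoiders_iff avoids_def order_isomorphic_def)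

text \<open>Both flags are \<open>False\<close>: the left block is followed by the larger
  \<open>b\<close>, and the right block ends the list. An even \<open>b\<close> needs a nonempty
  right block, so \<open>k < b\<close>; an odd \<open>b\<close> must stand last, so
  \<open>k = b\<close>.\<close>

lemma parity_avoiders_231_Suc:
  assumes "a \<le> b"
  shows "parity_avoiders [2, 3, 1] False a (Suc b) =
    (\<lambda>(k, xs, ys). xs @ b # ys) ` (SIGMA k:{k\<in>{a..b}. even b \<longleftrightarrow> k < b}.
       parity_avoiders [2, 3, 1] False a k \<times> parity_avoiders [2, 3, 1] False k b)"
    (is "?L = ?R")
proof (intro set_eqI iffI)
  fix p assume p: "p \<in> ?L"
  then have "b \<in> set p" using assms by (simp add: in_parity_avoiders_iff)
  then obtain xs ys where xy: "p = xs @ b # ys" by (meson split_list)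
  have d: "distinct (xs @ ys)" "b \<notin> set xs \<union> set ys" "insert b (set xs \<union> set ys) = {a..<Suc b}"
    using p by (auto simp: in_parity_avoiders_iff xy)
  have u: "set xs \<union> set ys = {a..<b}"
  proof -
    have "set xs \<union> set ys = insert b (set xs \<union> set ys) - {b}" using d(2) by blast
    also have "\<dots> = {a..<b}" unfolding d(3) by auto
    finally show ?thesis .
  qed
  then have lt: "\<forall>x\<in>set xs \<union> set ys. x < b" by simp
  have av: "avoids xs [2, 3, 1]" "avoids ys [2, 3, 1]" "\<forall>x\<in>set xs. \<forall>y\<in>set ys. x < y"
    using p avoids_231_split_max_iff[OF lt d(1)] by (simp_all add: in_parity_avoiders_iff xy)
  obtain k where k: "k \<in> {a..b}" "set xs = {a..<k}" "set ys = {k..<b}"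
    using interval_split[OF u av(3) assms] by blast
  have "parity_descents False xs \<and> even b = (ys \<noteq> []) \<and> parity_descents False ys"
    using p lt by (simp add: in_parity_avoiders_iff xy parity_descents_append_larger parity_descents_Cons_max)
  moreover have "ys \<noteq> [] \<longleftrightarrow> k < b"
    using k by (metis atLeastLessThan_empty_iff set_empty)
  ultimately show "p \<in> ?R"
    using k av d(1) unfolding xy
    by (intro image_eqI[where x = "(k, xs, ys)"]) (simp_all add: in_parity_avoiders_iff)
next
  fix p assume "p \<in> ?R"
  then obtain k xs ys where p: "p = xs @ b # ys" and k: "k \<in> {a..b}" "even b \<longleftrightarrow> k < b"
    and xs: "xs \<in> parity_avoiders [2, 3, 1] False a k"
    and ys: "ys \<in> parity_avoiders [2, 3, 1] False k b"
    by auto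
  have s: "set xs = {a..<k}" "set ys = {k..<b}" and d: "distinct xs" "distinct ys"
    using xs ys by (auto simp: in_parity_avoiders_iff)
  have lt: "\<forall>x\<in>set xs \<union> set ys. x < b" and d': "distinct (xs @ ys)"
    using s d k(1) by auto
  have "ys \<noteq> [] \<longleftrightarrow> k < b"
    using s by (metis atLeastLessThan_empty_iff set_empty)
  then have "parity_descents False p"
    using xs ys lt k(2) by (simp add: p in_parity_avoiders_iff parity_descents_append_larger parity_descents_Cons_max)
  moreover have "avoids p [2, 3, 1]"
    unfolding p avoids_231_split_max_iff[OF lt d']
    using xs ys s by (auto simp: in_parity_avoiders_iff simp del: One_nat_def)
  moreover have "set p = {a..<Suc b}" "distinct p"
    using s d k(1) by (auto simp: p)
  ultimately show "p \<in> ?L"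
    by (simp add: in_parity_avoiders_iff)
qed

lemma card_parity_avoiders_231_Suc:
  assumes "a \<le> b"
  shows "card (parity_avoiders [2, 3, 1] False a (Suc b)) =
    (\<Sum>k\<in>{k\<in>{a..b}. even b \<longleftrightarrow> k < b}. card (parity_avoiders [2, 3, 1] False a k) *
       card (parity_avoiders [2, 3, 1] False k b))"
  unfolding parity_avoiders_231_Suc[OF assms]
proof (rule card_image_split[where f = "\<lambda>xs. a + length xs"])
  fix k xs assume "k \<in> {k\<in>{a..b}. even b \<longleftrightarrow> k < b}" "xs \<in> parity_avoiders [2, 3, 1] False a k"
  then show "b \<notin> set xs \<and> k = a + length xs"
    using length_parity_avoiders[of xs "[2, 3, 1]" False a k] by (simp add: in_parity_avoiders_iff)
next
  fix k ys assume "ys \<in> parity_avoiders [2, 3, 1] False k b"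
  then show "b \<notin> set ys"
    by (simp add: in_parity_avoiders_iff)
qed simp_all

text \<open>The left block is followed by the smaller \<open>a\<close>, hence \<open>True\<close>;
  the right block inherits \<open>c\<close>. The minimum counts as followed by a smaller value only
  if it stands last and \<open>c\<close> holds, and the condition on \<open>k\<close> says that this
  happens exactly for even \<open>a\<close>.\<close>

lemma parity_avoiders_312_split:
  assumes "a < b"
  shows "parity_avoiders [3, 1, 2] c a b =
    (\<lambda>(k, xs, ys). xs @ a # ys) ` (SIGMA k:{k\<in>{Suc a..b}. even a \<longleftrightarrow> k = b \<and> c}.
       parity_avoiders [3, 1, 2] True (Suc a) k \<times> parity_avoiders [3, 1, 2] c k b)"
    (is "?L = ?R")
proof (intro set_eqI iffI)
  fix p assume p: "p \<in> ?L"
  then have "a \<in> set p" using assms by (simp add: in_parity_avoiders_iff)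
  then obtain xs ys where xy: "p = xs @ a # ys" by (meson split_list)
  have d: "distinct (xs @ ys)" "a \<notin> set xs \<union> set ys" "insert a (set xs \<union> set ys) = {a..<b}"
    using p by (auto simp: in_parity_avoiders_iff xy)
  have u: "set xs \<union> set ys = {Suc a..<b}"
  proof -
    have "set xs \<union> set ys = insert a (set xs \<union> set ys) - {a}" using d(2) by blast
    also have "\<dots> = {Suc a..<b}" unfolding d(3) by auto
    finally show ?thesis .
  qed
  then have lt: "\<forall>x\<in>set xs \<union> set ys. a < x" by simp
  have av: "avoids xs [3, 1, 2]" "avoids ys [3, 1, 2]" "\<forall>x\<in>set xs. \<forall>y\<in>set ys. x < y"
    using p avoids_312_split_min_iff[OF lt d(1)] by (simp_all add: in_parity_avoiders_iff xy)
  obtain k where k: "k \<in> {Suc a..b}" "set xs = {Suc a..<k}" "set ys = {k..<b}"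
    using interval_split[OF u av(3)] assms by (metis Suc_leI)
  have "parity_descents True xs \<and> even a = (ys = [] \<and> c) \<and> parity_descents c ys"
    using p lt by (simp add: in_parity_avoiders_iff xy parity_descents_append_smaller parity_descents_Cons_min)
  moreover have "ys = [] \<longleftrightarrow> k = b"
    using k by (metis atLeastLessThan_empty_iff set_empty atLeastAtMost_iff le_less less_irrefl)
  ultimately show "p \<in> ?R"
    using k av d(1) unfolding xy
    by (intro image_eqI[where x = "(k, xs, ys)"]) (simp_all add: in_parity_avoiders_iff)
next
  fix p assume "p \<in> ?R"
  then obtain k xs ys where p: "p = xs @ a # ys" and k: "k \<in> {Suc a..b}" "even a \<longleftrightarrow> k = b \<and> c"
    and xs: "xs \<in> parity_avoiders [3, 1, 2] True (Suc a) k"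
    and ys: "ys \<in> parity_avoiders [3, 1, 2] c k b"
    by auto
  have s: "set xs = {Suc a..<k}" "set ys = {k..<b}" and d: "distinct xs" "distinct ys"
    using xs ys by (auto simp: in_parity_avoiders_iff)
  have lt: "\<forall>x\<in>set xs \<union> set ys. a < x" and d': "distinct (xs @ ys)"
    using s d k(1) by auto
  have "ys = [] \<longleftrightarrow> k = b"
    using s k by (metis atLeastLessThan_empty_iff set_empty atLeastAtMost_iff le_less less_irrefl)
  then have "parity_descents c p"
    using xs ys lt k(2) by (simp add: p in_parity_avoiders_iff parity_descents_append_smaller parity_descents_Cons_min)
  moreover have "avoids p [3, 1, 2]"
    unfolding p avoids_312_split_min_iff[OF lt d']
    using xs ys s by (auto simp: in_parity_avoiders_iff simp del: One_nat_def)
  moreover have "set p = {a..<b}" "distinct p"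
    using s d k(1) assms by (auto simp: p)
  ultimately show "p \<in> ?L"
    by (simp add: in_parity_avoiders_iff)
qed

lemma card_parity_avoiders_312_split:
  assumes "a < b"
  shows "card (parity_avoiders [3, 1, 2] c a b) =
    (\<Sum>k\<in>{k\<in>{Suc a..b}. even a \<longleftrightarrow> k = b \<and> c}. card (parity_avoiders [3, 1, 2] True (Suc a) k) *
       card (parity_avoiders [3, 1, 2] c k b))"
  unfolding parity_avoiders_312_split[OF assms]
proof (rule card_image_split[where f = "\<lambda>xs. Suc a + length xs"])
  fix k xs assume "k \<in> {k\<in>{Suc a..b}. even a \<longleftrightarrow> k = b \<and> c}"
    "xs \<in> parity_avoiders [3, 1, 2] True (Suc a) k"
  then show "a \<notin> set xs \<and> k = Suc a + length xs"
    using length_parity_avoiders[of xs "[3, 1, 2]" True "Suc a" k] by (simp add: in_parity_avoiders_iff)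
next
  fix k ys assume "k \<in> {k\<in>{Suc a..b}. even a \<longleftrightarrow> k = b \<and> c}" "ys \<in> parity_avoiders [3, 1, 2] c k b"
  then show "a \<notin> set ys"
    by (simp add: in_parity_avoiders_iff)
qed simp_all

section \<open>Solving the recurrences\<close>

lemma card_parity_avoiders_231:
  assumes "a \<le> b"
  shows "real (card (parity_avoiders [2, 3, 1] False a b)) =
    (if odd a then catalan ((b - a) div 2) else if a = b then 1 else 0)"
  using assms
proof (induction b arbitrary: a rule: less_induct)
  case (less b)
  let ?X = "\<lambda>a b. real (card (parity_avoiders [2, 3, 1] False a b))"
  show ?case
  proof (cases "a = b")
    case True
    then show ?thesis by simp
  next
    case False
    then obtain b' where b: "b = Suc b'" "a \<le> b'"
      using less.prems by (cases b) auto
    have IH: "?X k l = (if odd k then catalan ((l - k) div 2) else if k = l then 1 else 0)"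
      if "k \<le> l" "l \<le> b'" for k l
      using less.IH[of l k] that b(1) by auto
    have split: "?X a b = (\<Sum>k\<in>{k\<in>{a..b'}. even b' \<longleftrightarrow> k < b'}. ?X a k * ?X k b')"
      using card_parity_avoiders_231_Suc[OF b(2)] by (simp add: b(1))
    show ?thesis
    proof (cases "even b'")
      case False
      \<comment> \<open>An odd maximum stands last, so only the cut at \<open>b'\<close>
        survives.\<close>
      then have "{k\<in>{a..b'}. even b' \<longleftrightarrow> k < b'} = {b'}"
        using b(2) by auto
      then have "?X a b = ?X a b' * ?X b' b'"
        using split by simp
      also have "\<dots> = (if odd a then catalan ((b' - a) div 2) else if a = b' then 1 else 0)"
        using IH[of a b'] b(2) by simp
      \<comment> \<open>For odd \<open>a\<close> the difference \<open>b' - a\<close> is even, so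
        one more entry leaves the half unchanged; an even \<open>a\<close> cannot equal the odd
        \<open>b'\<close>.\<close>
      also have "odd a \<Longrightarrow> (b' - a) div 2 = (b - a) div 2"
        using False b by (simp add: Suc_diff_le)
      then have "(if odd a then catalan ((b' - a) div 2) else if a = b' then 1 else 0) =
          (if odd a then catalan ((b - a) div 2) else if a = b then 1 else 0)"
        using False b by auto
      finally show ?thesis .
    next
      case even: True
      then have "{k\<in>{a..b'}. even b' \<longleftrightarrow> k < b'} = {a..<b'}"
        by auto
      then have X: "?X a b = (\<Sum>k\<in>{a..<b'}. ?X a k * ?X k b')"
        using split by simp
      show ?thesis
      proof (cases "even a")
        case True
        \<comment> \<open>Some factor counts a nonempty block starting at the even \<open>a\<close>:
          the right one if \<open>k = a\<close>, the left one otherwise.\<close>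
        have "?X a k * ?X k b' = 0" if "k \<in> {a..<b'}" for k
          using that IH[of a k] IH[of k b'] True by (cases "k = a") simp_all
        then have "?X a b = 0"
          unfolding X by (intro sum.neutral ballI)
        then show ?thesis using True \<open>a \<noteq> b\<close> by simp
      next
        case False
        define m where "m = (b' - a) div 2"
        have m: "b' - a = 2 * m + 1"
          using False even b(2) unfolding m_def by presburger
        have "?X a b = (\<Sum>j<b' - a. ?X a (a + j) * ?X (a + j) b')"
          unfolding X by (simp add: sum.atLeastLessThan_shift_0[of _ a b'] lessThan_atLeast0)
        \<comment> \<open>At odd \<open>j\<close> the right block is nonempty and starts at the even
          value \<open>a + j\<close>. At even \<open>j\<close> the lengths \<open>j\<close> and
          \<open>2 * m + 1 - j\<close> halve to \<open>j div 2\<close> and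
          \<open>m - j div 2\<close>.\<close>
        also have "\<dots> = (\<Sum>j<b' - a. if even j then catalan (j div 2) * catalan (m - j div 2) else 0)"
        proof (rule sum.cong)
          fix j assume "j \<in> {..<b' - a}"
          then have j: "j < b' - a" "a + j < b'" by auto
          show "?X a (a + j) * ?X (a + j) b' =
              (if even j then catalan (j div 2) * catalan (m - j div 2) else 0)"
          proof (cases "even j")
            case True
            then have "(b' - (a + j)) div 2 = m - j div 2"
              using m by auto
            then show ?thesis
              using True False j IH[of a "a + j"] IH[of "a + j" b'] by simp
          next
            case odd: False
            then show ?thesis
              using False j IH[of "a + j" b'] by simp
          qed
        qed simp
        also have "\<dots> = catalan (Suc m)"
          unfolding sum_even_offsets[of "\<lambda>i. catalan i * catalan (m - i)"] m
          using catalan_convolution[of m] by (simp add: lessThan_Suc_atMost)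
        finally show ?thesis
          using False m b by (simp add: Suc_diff_le)
      qed
    qed
  qed
qed

text \<open>Source of the zeros: with this flag the maximum \<open>b - 1\<close> is always followed
  by something smaller, so a nonempty block needs \<open>b\<close> odd. An even minimum stands last
  and can be removed; an odd one leads to the convolution. The induction is on the length because
  blocks change at both ends.\<close>

lemma card_parity_avoiders_312_True:
  assumes "a \<le> b"
  shows "real (card (parity_avoiders [3, 1, 2] True a b)) =
    (if odd a then if even (b - a) then catalan ((b - a) div 2) else 0
     else if a = b then 1 else if odd (b - a) then catalan ((b - a) div 2) else 0)"
  using assms
proof (induction "b - a" arbitrary: a b rule: less_induct)
  case less
  let ?T = "\<lambda>a b. real (card (parity_avoiders [3, 1, 2] True a b))"
  show ?case
  proof (cases "a = b")
    case True
    then show ?thesis by simp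
  next
    case False
    then have ab: "a < b" using less.prems by simp
    have IH: "?T k l = (if odd k then if even (l - k) then catalan ((l - k) div 2) else 0
         else if k = l then 1 else if odd (l - k) then catalan ((l - k) div 2) else 0)"
      if "a < k" "k \<le> l" "l \<le> b" for k l
      using less.hyps[of l k] that ab by auto
    have split: "?T a b = (\<Sum>k\<in>{k\<in>{Suc a..b}. even a \<longleftrightarrow> k = b}. ?T (Suc a) k * ?T k b)"
      using card_parity_avoiders_312_split[OF ab, of True] by simp
    show ?thesis
    proof (cases "even a")
      case True
      then have "{k\<in>{Suc a..b}. even a \<longleftrightarrow> k = b} = {b}"
        using ab by auto
      then have "?T a b = ?T (Suc a) b"
        using split by simp
      also have "\<dots> = (if odd (b - a) then catalan ((b - a) div 2) else 0)"
      proof -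
        have "even (b - Suc a) \<longleftrightarrow> odd (b - a)" "odd (b - a) \<Longrightarrow> (b - Suc a) div 2 = (b - a) div 2"
          using ab by presburger+
        then show ?thesis
          using IH[of "Suc a" b] True ab by simp
      qed
      finally show ?thesis using True False by simp
    next
      case odd: False
      define n where "n = b - Suc a"
      have "{k\<in>{Suc a..b}. even a \<longleftrightarrow> k = b} = {Suc a..<b}"
        using odd by auto
      then have "?T a b = (\<Sum>j<n. ?T (Suc a) (Suc a + j) * ?T (Suc a + j) b)"
        using split by (simp add: sum.atLeastLessThan_shift_0[of _ "Suc a" b] lessThan_atLeast0 n_def)
      \<comment> \<open>The left block starts at the even \<open>Suc a\<close>, so it is empty or
        has odd length \<open>j\<close>. In either case the right block, of length
        \<open>n - j\<close>, contributes only if \<open>n\<close> is odd.\<close>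
      also have "\<dots> = (\<Sum>j<n. if even n then 0 else if j = 0 then catalan (n div 2)
           else if odd j then catalan (j div 2) * catalan (n div 2 - j div 2) else 0)"
      proof (rule sum.cong)
        fix j assume "j \<in> {..<n}"
        then have j: "j < n" by simp
        have *: "Suc a + j \<le> b" "Suc a + j \<noteq> b" "b - (Suc a + j) = n - j"
          using j unfolding n_def by auto
        have T1: "?T (Suc a) (Suc a + j) =
            (if j = 0 then 1 else if odd j then catalan (j div 2) else 0)"
          using IH[of "Suc a" "Suc a + j"] * odd by simp
        have T2: "?T (Suc a + j) b = (if odd j then if even (n - j) then catalan ((n - j) div 2) else 0
            else if odd (n - j) then catalan ((n - j) div 2) else 0)"
          using IH[of "Suc a + j" b] * odd by simp
        have "odd j \<Longrightarrow> odd n \<Longrightarrow> (n - j) div 2 = n div 2 - j div 2"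
          using j by (auto elim!: oddE)
        moreover have "even (n - j) \<longleftrightarrow> (even n \<longleftrightarrow> even j)"
          using j by (auto simp: even_diff_nat)
        ultimately show "?T (Suc a) (Suc a + j) * ?T (Suc a + j) b =
            (if even n then 0 else if j = 0 then catalan (n div 2)
             else if odd j then catalan (j div 2) * catalan (n div 2 - j div 2) else 0)"
          by (simp only: T1 T2) (cases "j = 0"; cases "even j"; cases "even n"; simp)
      qed simp
      also have "\<dots> = (if odd n then catalan (Suc (n div 2)) else 0)"
      proof (cases "even n")
        case False
        define m where "m = n div 2"
        have n: "n = Suc (2 * m)" using False unfolding m_def by presburger
        \<comment> \<open>The peeled term \<open>j = 0\<close> is
          \<open>catalan m * catalan 0\<close>, exactly the summand \<open>i = m\<close> that the
          remaining terms lack.\<close>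
        have "(\<Sum>j<n. if even n then 0 else if j = 0 then catalan (n div 2)
             else if odd j then catalan (j div 2) * catalan (n div 2 - j div 2) else 0) =
            catalan m + (\<Sum>j<2 * m. if even j then catalan (j div 2) * catalan (m - j div 2) else 0)"
          unfolding n by (subst sum.lessThan_Suc_shift) (auto intro!: sum.cong)
        also have "\<dots> = (\<Sum>i<Suc m. catalan i * catalan (m - i))"
          unfolding sum_even_offsets[of "\<lambda>i. catalan i * catalan (m - i)"] by simp
        also have "\<dots> = catalan (Suc m)"
          using catalan_convolution[of m] by (simp add: lessThan_Suc_atMost)
        finally show ?thesis using False by (simp add: m_def)
      qed simp
      also have "\<dots> = (if even (b - a) then catalan ((b - a) div 2) else 0)"
      proof -
        have "b - a = Suc n" using ab by (simp add: n_def)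
        then show ?thesis by auto
      qed
      finally show ?thesis using odd by simp
    qed
  qed
qed

text \<open>Left blocks are counted by the flag \<open>True\<close> formula already solved, while
  right blocks stay in this class and keep the end \<open>b\<close>, which can therefore be fixed in
  the induction. An even minimum has no smaller value after it, so no cut is possible.\<close>

lemma card_parity_avoiders_312_False:
  assumes "a \<le> b"
  shows "real (card (parity_avoiders [3, 1, 2] False a b)) =
    (if odd a then catalan ((b - a) div 2) else if a = b then 1 else 0)"
  using assms
proof (induction "b - a" arbitrary: a rule: less_induct)
  case less
  let ?T = "\<lambda>a b. real (card (parity_avoiders [3, 1, 2] True a b))"
  let ?F = "\<lambda>a b. real (card (parity_avoiders [3, 1, 2] False a b))"
  show ?case
  proof (cases "a = b")
    case True
    then show ?thesis by simp
  next
    case False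
    then have ab: "a < b" using less.prems by simp
    have IH: "?F k b = (if odd k then catalan ((b - k) div 2) else if k = b then 1 else 0)"
      if "a < k" "k \<le> b" for k
      using less.hyps[of k] that ab by auto
    have split: "?F a b = (\<Sum>k\<in>{k\<in>{Suc a..b}. odd a}. ?T (Suc a) k * ?F k b)"
      using card_parity_avoiders_312_split[OF ab, of False] by simp
    show ?thesis
    proof (cases "even a")
      case True
      then show ?thesis using split False by simp
    next
      case odd: False
      define n where "n = b - Suc a"
      have "{k\<in>{Suc a..b}. odd a} = {Suc a..<Suc b}"
        using odd by auto
      then have "?F a b = (\<Sum>j<Suc n. ?T (Suc a) (Suc a + j) * ?F (Suc a + j) b)"
        using split ab
        by (simp only: sum.atLeastLessThan_shift_0[of _ "Suc a" "Suc b"] lessThan_atLeast0 n_def)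
           (simp add: Suc_diff_Suc)
      \<comment> \<open>For \<open>j = 0\<close> the right block starts at the even
        \<open>Suc a\<close> and must be empty, which means \<open>n = 0\<close>. For even
        \<open>j > 0\<close> the left block already contributes 0.\<close>
      also have "\<dots> = (\<Sum>j<Suc n. if j = 0 then if n = 0 then 1 else 0
           else if odd j then catalan (j div 2) * catalan ((n - j) div 2) else 0)"
      proof (rule sum.cong)
        fix j assume "j \<in> {..<Suc n}"
        then have *: "Suc a + j \<le> b" "b - (Suc a + j) = n - j" "Suc a + j = b \<longleftrightarrow> j = n"
          using ab unfolding n_def by auto
        have T: "?T (Suc a) (Suc a + j) =
            (if j = 0 then 1 else if odd j then catalan (j div 2) else 0)"
          using card_parity_avoiders_312_True[of "Suc a" "Suc a + j"] odd by simp
        have F: "?F (Suc a + j) b = (if odd j then catalan ((n - j) div 2) else if j = n then 1 else 0)"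
          using IH[of "Suc a + j"] * odd by simp
        show "?T (Suc a) (Suc a + j) * ?F (Suc a + j) b =
            (if j = 0 then if n = 0 then 1 else 0
             else if odd j then catalan (j div 2) * catalan ((n - j) div 2) else 0)"
          unfolding T F by simp
      qed simp
      also have "\<dots> = catalan ((n + 1) div 2)"
      proof (cases "n = 0")
        case False
        \<comment> \<open>So \<open>n\<close> is \<open>2 * m + 1\<close> or
          \<open>2 * m + 2\<close>; the half-lengths of the right blocks agree in both
          cases.\<close>
        define m where "m = (n - 1) div 2"
        have m: "(n + 1) div 2 = Suc m" using False unfolding m_def by presburger
        have "(\<Sum>j<Suc n. if j = 0 then if n = 0 then 1 else 0
             else if odd j then catalan (j div 2) * catalan ((n - j) div 2) else 0) =
            (\<Sum>j<n. if odd (Suc j) then catalan (Suc j div 2) * catalan ((n - Suc j) div 2) else 0)"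
          by (subst sum.lessThan_Suc_shift) (use False in simp)
        also have "\<dots> = (\<Sum>j<n. if even j then catalan (j div 2) * catalan (m - j div 2) else 0)"
        proof (rule sum.cong)
          fix j assume "j \<in> {..<n}"
          then have "j < n" by simp
          then have "even j \<Longrightarrow> (n - Suc j) div 2 = m - j div 2"
            unfolding m_def by (elim evenE) simp
          then show "(if odd (Suc j) then catalan (Suc j div 2) * catalan ((n - Suc j) div 2) else 0) =
              (if even j then catalan (j div 2) * catalan (m - j div 2) else 0)"
            by simp
        qed simp
        also have "\<dots> = (\<Sum>i<Suc m. catalan i * catalan (m - i))"
          unfolding sum_even_offsets[of "\<lambda>i. catalan i * catalan (m - i)"] m ..
        also have "\<dots> = catalan (Suc m)"
          using catalan_convolution[of m] by (simp add: lessThan_Suc_atMost)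
        finally show ?thesis by (simp only: m)
      qed simp
      also have "n + 1 = b - a" using ab by (simp add: n_def)
      finally show ?thesis using odd by simp
    qed
  qed
qed

lemma dumont_first_avoiders_eq:
  "{p \<in> permutations_of_set {1..n}. dumont_first p \<and> avoids p pat} =
     parity_avoiders pat False 1 (Suc n)"
  unfolding parity_avoiders_def atLeastLessThanSuc_atLeastAtMost
  using dumont_first_iff_parity_descents permutations_of_setD(2) by blast

subsection \<open>Dumont permutations of the second kind\<close>

text \<open>
  \<open>u\<close> and \<open>v\<close> stand for the entries at the odd and the even positions. Reading
  $1, 2, \dots, a + b$ and recording which list contains the current value gives a ballot
  sequence.
\<close>

definition ballot_pairs :: "nat \<Rightarrow> nat \<Rightarrow> (nat list \<times> nat list) set" where
  "ballot_pairs a b = {(u, v). length u = a \<and> length v = b \<and>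
     sorted_wrt (<) u \<and> sorted_wrt (<) v \<and> set u \<union> set v = {1..a + b} \<and>
     (\<forall>j<a. 2 * j + 1 \<le> u ! j) \<and> (\<forall>j<b. v ! j \<le> 2 * j + 1)}"

section \<open>Counting ballot pairs by the place of the largest value\<close>

lemma finite_ballot_pairs [simp]: "finite (ballot_pairs a b)"
proof (rule finite_subset)
  show "ballot_pairs a b \<subseteq>
      {u. set u \<subseteq> {1..a + b} \<and> length u = a} \<times> {v. set v \<subseteq> {1..a + b} \<and> length v = b}"
    unfolding ballot_pairs_def by blast
qed (simp add: finite_lists_length_eq)

text \<open>The \<open>a + b\<close> entries cover \<open>a + b\<close> values, so none
  repeats.\<close>

lemma distinct_ballot_pairs:
  assumes "(u, v) \<in> ballot_pairs a b"
  shows "distinct (u @ v)"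
proof (rule card_distinct)
  show "card (set (u @ v)) = length (u @ v)"
    using assms by (simp add: ballot_pairs_def)
qed

lemma atLeastAtMost_Suc_Diff: "{1..Suc n} - {Suc n} = {1..n}"
  by auto

text \<open>The appended entry has index \<open>a\<close>, and its bound
  \<open>2 * a + 1 <= a + b + 1\<close> is the ballot condition \<open>a <= b\<close>.\<close>

lemma snoc_fst_ballot_pairs_iff:
  "(u @ [Suc (a + b)], v) \<in> ballot_pairs (Suc a) b \<longleftrightarrow> (u, v) \<in> ballot_pairs a b \<and> a \<le> b"
proof
  assume *: "(u @ [Suc (a + b)], v) \<in> ballot_pairs (Suc a) b"
  have "Suc (a + b) \<notin> set u \<union> set v"
    using distinct_ballot_pairs[OF *] by auto
  then have "set u \<union> set v = insert (Suc (a + b)) (set u \<union> set v) - {Suc (a + b)}"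
    by blast
  also have "insert (Suc (a + b)) (set u \<union> set v) = {1..Suc (a + b)}"
    using * by (simp add: ballot_pairs_def)
  finally have "set u \<union> set v = {1..a + b}"
    by (simp only: atLeastAtMost_Suc_Diff)
  moreover have "2 * j + 1 \<le> u ! j" if "j < a" for j
    using * that by (auto simp: ballot_pairs_def nth_append dest: spec[of _ j])
  moreover have "a \<le> b"
    using * by (auto simp: ballot_pairs_def nth_append dest: spec[of _ a])
  ultimately show "(u, v) \<in> ballot_pairs a b \<and> a \<le> b"
    using * by (simp add: ballot_pairs_def sorted_wrt_append)
next
  assume *: "(u, v) \<in> ballot_pairs a b \<and> a \<le> b"
  then have s: "set u \<union> set v = {1..a + b}" by (simp add: ballot_pairs_def)
  then have "\<forall>y\<in>set u. y < Suc (a + b)" by (metis UnCI atLeastAtMost_iff le_imp_less_Suc)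
  moreover have "insert (Suc (a + b)) (set u \<union> set v) = {1..Suc (a + b)}"
    unfolding s by auto
  ultimately show "(u @ [Suc (a + b)], v) \<in> ballot_pairs (Suc a) b"
    using * by (simp add: ballot_pairs_def sorted_wrt_append nth_append)
qed

text \<open>At index \<open>b\<close> the bound \<open>a + b + 1 <= 2 * b + 1\<close> is again
  \<open>a <= b\<close>. Every step thus starts from a state with \<open>a <= b\<close>, and only
  the final state may have \<open>a = b + 1\<close>.\<close>

lemma snoc_snd_ballot_pairs_iff:
  "(u, v @ [Suc (a + b)]) \<in> ballot_pairs a (Suc b) \<longleftrightarrow> (u, v) \<in> ballot_pairs a b \<and> a \<le> b"
proof
  assume *: "(u, v @ [Suc (a + b)]) \<in> ballot_pairs a (Suc b)"
  have "Suc (a + b) \<notin> set u \<union> set v"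
    using distinct_ballot_pairs[OF *] by auto
  then have "set u \<union> set v = insert (Suc (a + b)) (set u \<union> set v) - {Suc (a + b)}"
    by blast
  also have "insert (Suc (a + b)) (set u \<union> set v) = {1..Suc (a + b)}"
    using * by (simp add: ballot_pairs_def)
  finally have "set u \<union> set v = {1..a + b}"
    by (simp only: atLeastAtMost_Suc_Diff)
  moreover have "v ! j \<le> 2 * j + 1" if "j < b" for j
    using * that by (auto simp: ballot_pairs_def nth_append dest: spec[of _ j])
  moreover have "a \<le> b"
    using * by (auto simp: ballot_pairs_def nth_append dest: spec[of _ b])
  ultimately show "(u, v) \<in> ballot_pairs a b \<and> a \<le> b"
    using * by (simp add: ballot_pairs_def sorted_wrt_append)
next
  assume *: "(u, v) \<in> ballot_pairs a b \<and> a \<le> b"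
  then have s: "set u \<union> set v = {1..a + b}" by (simp add: ballot_pairs_def)
  then have "\<forall>y\<in>set v. y < Suc (a + b)" by (metis UnCI atLeastAtMost_iff le_imp_less_Suc)
  moreover have "insert (Suc (a + b)) (set u \<union> set v) = {1..Suc (a + b)}"
    unfolding s by auto
  ultimately show "(u, v @ [Suc (a + b)]) \<in> ballot_pairs a (Suc b)"
    using * by (simp add: ballot_pairs_def sorted_wrt_append nth_append)
qed

lemma strict_sorted_max_snoc:
  fixes m :: nat
  assumes "sorted_wrt (<) xs" "m \<in> set xs" "\<forall>x\<in>set xs. x \<le> m"
  obtains ys where "xs = ys @ [m]"
proof -
  have ne: "xs \<noteq> []" using assms(2) by auto
  then have xs: "xs = butlast xs @ [last xs]" by simp
  then have "\<forall>x\<in>set (butlast xs). x < last xs"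
    using assms(1) by (metis sorted_wrt_append list.set_intros(1))
  moreover have "m \<in> set (butlast xs) \<or> m = last xs"
    using assms(2) xs by (metis Un_iff empty_iff empty_set insert_iff list.simps(15) set_append)
  moreover have "last xs \<le> m" using assms(3) ne by simp
  ultimately have "last xs = m" by auto
  with xs that show thesis by metis
qed

text \<open>Both lists increase and share no value, so the largest value ends exactly one of
  them.\<close>

lemma card_ballot_pairs_split:
  assumes "a + b = Suc t"
  shows "card (ballot_pairs a b) =
    card {(u, v). (u @ [Suc t], v) \<in> ballot_pairs a b} +
    card {(u, v). (u, v @ [Suc t]) \<in> ballot_pairs a b}"
proof -
  let ?A = "{(u, v). (u @ [Suc t], v) \<in> ballot_pairs a b}"
  let ?B = "{(u, v). (u, v @ [Suc t]) \<in> ballot_pairs a b}"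
  let ?f = "\<lambda>(u, v). (u @ [Suc t], v)" and ?g = "\<lambda>(u, v). (u, v @ [Suc t])"
  have "ballot_pairs a b \<subseteq> ?f ` ?A \<union> ?g ` ?B"
  proof
    fix w assume "w \<in> ballot_pairs a b"
    then obtain u v where w: "w = (u, v)" "(u, v) \<in> ballot_pairs a b" by (cases w) auto
    then have s: "set u \<union> set v = {1..Suc t}" and srt: "sorted_wrt (<) u" "sorted_wrt (<) v"
      using assms by (simp_all add: ballot_pairs_def)
    have le: "\<forall>x\<in>set u. x \<le> Suc t" "\<forall>x\<in>set v. x \<le> Suc t"
      using s by (metis UnCI atLeastAtMost_iff)+
    have "Suc t \<in> set u \<union> set v" unfolding s by simp
    then consider "Suc t \<in> set u" | "Suc t \<in> set v" by blast
    then show "w \<in> ?f ` ?A \<union> ?g ` ?B"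
    proof cases
      case 1
      then obtain u' where "u = u' @ [Suc t]"
        using strict_sorted_max_snoc srt(1) le(1) by blast
      then show ?thesis using w by (auto simp: image_iff)
    next
      case 2
      then obtain v' where "v = v' @ [Suc t]"
        using strict_sorted_max_snoc srt(2) le(2) by blast
      then show ?thesis using w by (auto simp: image_iff)
    qed
  qed
  then have eq: "ballot_pairs a b = ?f ` ?A \<union> ?g ` ?B" by auto
  have disj: "?f ` ?A \<inter> ?g ` ?B = {}"
    using distinct_ballot_pairs[of _ _ a b] by fastforce
  have inj: "inj_on ?f ?A" "inj_on ?g ?B" by (auto simp: inj_on_def)
  have "finite (?f ` ?A \<union> ?g ` ?B)"
    by (metis eq finite_ballot_pairs)
  then have "card (?f ` ?A \<union> ?g ` ?B) = card (?f ` ?A) + card (?g ` ?B)"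
    using disj by (simp add: card_Un_disjoint)
  then show ?thesis
    using inj eq by (simp add: card_image)
qed

lemma card_ballot_pairs_Suc_Suc:
  "card (ballot_pairs (Suc a) (Suc b)) =
    (if a \<le> Suc b then card (ballot_pairs a (Suc b)) else 0) +
    (if a < b then card (ballot_pairs (Suc a) b) else 0)"
  using card_ballot_pairs_split[of "Suc a" "Suc b" "Suc (a + b)"]
    snoc_fst_ballot_pairs_iff[of _ a "Suc b"] snoc_snd_ballot_pairs_iff[of _ _ "Suc a" b]
  by (simp add: Suc_le_eq)

lemma card_ballot_pairs_Suc_0:
  "card (ballot_pairs (Suc a) 0) = (if a = 0 then card (ballot_pairs 0 0) else 0)"
proof -
  have "{(u, v). (u, v @ [Suc a]) \<in> ballot_pairs (Suc a) 0} = {}"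
    by (auto simp: ballot_pairs_def)
  then show ?thesis
    using card_ballot_pairs_split[of "Suc a" 0 a] snoc_fst_ballot_pairs_iff[of _ a 0] by simp
qed

lemma card_ballot_pairs_0_Suc: "card (ballot_pairs 0 (Suc b)) = card (ballot_pairs 0 b)"
proof -
  have "{(u, v). (u @ [Suc b], v) \<in> ballot_pairs 0 (Suc b)} = {}"
    by (auto simp: ballot_pairs_def)
  then show ?thesis
    using card_ballot_pairs_split[of 0 "Suc b" b] snoc_snd_ballot_pairs_iff[of _ _ 0 b] by simp
qed

lemma card_ballot_pairs_0_0: "card (ballot_pairs 0 0) = 1"
proof -
  have "ballot_pairs 0 0 = {([], [])}" by (auto simp: ballot_pairs_def)
  then show ?thesis by simp
qed

text \<open>The ballot numbers in the form given by the reflection principle, verified by Pascal's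
  rule along the recurrence on the last step.\<close>

lemma card_ballot_pairs:
  assumes "a \<le> b"
  shows "int (card (ballot_pairs a b)) = int ((a + b) choose b) - int ((a + b) choose Suc b)"
  using assms
proof (induction "a + b" arbitrary: a b)
  case 0
  then show ?case by (simp add: card_ballot_pairs_0_0)
next
  case (Suc t)
  then obtain b' where b: "b = Suc b'" by (cases b) auto
  show ?case
  proof (cases a)
    case 0
    then show ?thesis
      using Suc.hyps(1)[of 0 b'] Suc.hyps(2) b by (simp add: card_ballot_pairs_0_Suc)
  next
    case a: (Suc a')
    have 1: "int (card (ballot_pairs a' b)) = int (t choose b) - int (t choose Suc b)"
      using Suc.hyps(1)[of a' b] Suc.hyps(2) Suc.prems a by simp
    show ?thesis
    proof (cases "a' < b'")
      case True
      have "int (card (ballot_pairs a b')) = int (t choose b') - int (t choose b)"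
        using Suc.hyps(1)[of a b'] Suc.hyps(2) True a b by simp
      then show ?thesis
        using 1 True Suc.hyps(2)[symmetric] card_ballot_pairs_Suc_Suc[of a' b'] by (simp add: a b)
    next
      case False
      then have "a' = b'" using Suc.prems a b by simp
      then have "t = b + b'" using Suc.hyps(2) a b by simp
      \<comment> \<open>On the diagonal the recurrence omits the step into \<open>v\<close>; by this
        symmetry the formula would assign that term the value 0 as well.\<close>
      then have "t choose b' = t choose b"
        using binomial_symmetric[of b' t] by simp
      then show ?thesis
        using 1 False \<open>a' = b'\<close> Suc.hyps(2)[symmetric] card_ballot_pairs_Suc_Suc[of a' b']
        by (simp add: a b)
    qed
  qed
qed

lemma card_ballot_pairs_diagonal: "real (card (ballot_pairs m m)) = catalan m"
proof -
  \<comment> \<open>The two binomials have ratio \<open>m / (m + 1)\<close>, so their difference is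
    the central one divided by \<open>m + 1\<close>.\<close>
  have "Suc m * ((2 * m) choose Suc m) = m * ((2 * m) choose m)"
    using binomial_absorption[of m "2 * m"] binomial_absorb_comp[of "2 * m" m] by auto
  then have "real (Suc m * ((2 * m) choose Suc m)) = real (m * ((2 * m) choose m))"
    by (simp only:)
  then have "real ((2 * m) choose m) - real ((2 * m) choose Suc m) = catalan m"
    unfolding catalan_def by (simp add: field_simps)
  moreover have "real (card (ballot_pairs m m)) = real_of_int (int (card (ballot_pairs m m)))"
    by simp
  ultimately show ?thesis
    using card_ballot_pairs[of m m] by (simp add: mult_2)
qed

text \<open>The last value must go to \<open>u\<close>: a last step into \<open>v\<close> would
  start from \<open>(m + 1, m - 1)\<close>, which violates the ballot condition.\<close>

lemma card_ballot_pairs_odd_diagonal: "card (ballot_pairs (Suc m) m) = card (ballot_pairs m m)"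
  by (cases m) (simp_all add: card_ballot_pairs_Suc_0 card_ballot_pairs_Suc_Suc)

section \<open>Occurrences of 321 by index\<close>

lemma subseq_Cons_nth_drop:
  assumes "subseq ys (drop (Suc j) xs)" "m \<le> j" "j < length xs"
  shows "subseq (xs ! j # ys) (drop m xs)"
proof -
  have "subseq (xs ! j # ys) (drop j xs)"
    using assms(1,3) by (simp flip: Cons_nth_drop_Suc)
  moreover have "drop m xs = take (j - m) (drop m xs) @ drop j xs"
    using assms(2) append_take_drop_id[of "j - m" "drop m xs"] by simp
  ultimately show ?thesis
    by (metis subseq_drop_many)
qed

lemma subseq_triple_iff_nth:
  "subseq [x, y, z] xs \<longleftrightarrow>
    (\<exists>i j k. i < j \<and> j < k \<and> k < length xs \<and> x = xs ! i \<and> y = xs ! j \<and> z = xs ! k)"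
proof
  assume "subseq [x, y, z] xs"
  from list_emb_ConsD[OF this] obtain us r where 1: "xs = us @ x # r" "subseq [y, z] r"
    by blast
  from list_emb_ConsD[OF 1(2)] obtain vs r' where 2: "r = vs @ y # r'" "subseq [z] r'"
    by blast
  then obtain ws r'' where 3: "r' = ws @ z # r''"
    by (metis subseq_singleton_left split_list)
  have xs: "xs = us @ x # vs @ y # ws @ z # r''"
    using 1 2 3 by simp
  show "\<exists>i j k. i < j \<and> j < k \<and> k < length xs \<and> x = xs ! i \<and> y = xs ! j \<and> z = xs ! k"
    by (rule exI[of _ "length us"], rule exI[of _ "length us + 1 + length vs"],
        rule exI[of _ "length us + 1 + length vs + 1 + length ws"])
       (simp add: xs nth_append)
next
  assume "\<exists>i j k. i < j \<and> j < k \<and> k < length xs \<and> x = xs ! i \<and> y = xs ! j \<and> z = xs ! k"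
  then obtain i j k where *: "i < j" "j < k" "k < length xs" "x = xs ! i" "y = xs ! j" "z = xs ! k"
    by blast
  have "subseq [z] (drop (Suc j) xs)"
    using subseq_Cons_nth_drop[of "[]" k xs "Suc j"] * by simp
  then have "subseq [y, z] (drop (Suc i) xs)"
    using subseq_Cons_nth_drop[of "[z]" j xs "Suc i"] * by simp
  then show "subseq [x, y, z] xs"
    using subseq_Cons_nth_drop[of "[y, z]" i xs 0] * by simp
qed

lemma avoids_321_iff_nth:
  "avoids xs [3, 2, 1] \<longleftrightarrow>
    (\<forall>i j k. i < j \<longrightarrow> j < k \<longrightarrow> k < length xs \<longrightarrow> xs ! j < xs ! i \<longrightarrow> \<not> xs ! k < xs ! j)"
  unfolding avoids_321_iff subseq_triple_iff_nth by blast

text \<open>Index \<open>i\<close> is position \<open>i + 1\<close>, so the parities swap and the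
  strict and weak inequalities trade places.\<close>

lemma dumont_second_iff_nth:
  "dumont_second xs \<longleftrightarrow> (\<forall>i<length xs. if even i then i < xs ! i else xs ! i \<le> i)"
  unfolding dumont_second_def ball_atLeast1_atMost_iff by (auto simp: Suc_le_eq less_Suc_eq_le)

text \<open>
  In this lemma and the next, a descent would leave too few positions on one side for the values
  below (respectively above) the weak excedance (deficiency), so that one of them would
  complete an occurrence of 321.
\<close>

lemma weak_excedances_increasing:
  assumes "set xs = {1..length xs}" "avoids xs [3, 2, 1]"
    and "i < j" "j < length xs" "j < xs ! j"
  shows "xs ! i < xs ! j"
proof (rule ccontr)
  let ?n = "length xs"
  assume "\<not> xs ! i < xs ! j"
  moreover have "distinct xs" using assms(1) by (intro card_distinct) simp
  then have "xs ! i \<noteq> xs ! j" using assms(3,4) by (simp add: nth_eq_iff_index_eq)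
  ultimately have ij: "xs ! j < xs ! i" by simp
  have "{1..<xs ! j} \<subseteq> (!) xs ` ({..<j} - {i})"
  proof
    fix v assume v: "v \<in> {1..<xs ! j}"
    have "xs ! j \<le> ?n" using assms(1,4) by (metis atLeastAtMost_iff nth_mem)
    with v have "v \<in> set xs" unfolding assms(1) by simp
    then obtain k where k: "k < ?n" "v = xs ! k" by (metis in_set_conv_nth)
    have "\<not> j < k" using assms(2-4) k ij v unfolding avoids_321_iff_nth by auto
    moreover have "k \<noteq> j" "k \<noteq> i" using k v ij by auto
    ultimately show "v \<in> (!) xs ` ({..<j} - {i})" using k by auto
  qed
  then have "card {1..<xs ! j} \<le> card ({..<j} - {i})"
    by (meson surj_card_le finite_Diff finite_lessThan)
  with assms(3,5) show False by simp
qed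

lemma deficiencies_increasing:
  assumes "set xs = {1..length xs}" "avoids xs [3, 2, 1]"
    and "i < j" "j < length xs" "xs ! i \<le> i"
  shows "xs ! i < xs ! j"
proof (rule ccontr)
  let ?n = "length xs"
  assume "\<not> xs ! i < xs ! j"
  moreover have "distinct xs" using assms(1) by (intro card_distinct) simp
  then have "xs ! i \<noteq> xs ! j" using assms(3,4) by (simp add: nth_eq_iff_index_eq)
  ultimately have ij: "xs ! j < xs ! i" by simp
  have "{xs ! i<..?n} \<subseteq> (!) xs ` ({Suc i..<?n} - {j})"
  proof
    fix v assume v: "v \<in> {xs ! i<..?n}"
    then have "v \<in> set xs" unfolding assms(1) by simp
    then obtain k where k: "k < ?n" "v = xs ! k" by (metis in_set_conv_nth)
    have "\<not> k < i" using assms(2-4) k ij v unfolding avoids_321_iff_nth by auto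
    moreover have "k \<noteq> j" "k \<noteq> i" using k v ij by auto
    ultimately show "v \<in> (!) xs ` ({Suc i..<?n} - {j})" using k by auto
  qed
  then have "card {xs ! i<..?n} \<le> card ({Suc i..<?n} - {j})"
    by (meson surj_card_le finite_Diff finite_atLeastLessThan)
  with assms(3-5) show False by simp
qed

section \<open>The bijection with ballot pairs\<close>

definition odd_even_entries :: "nat list \<Rightarrow> nat list \<times> nat list" where
  "odd_even_entries xs =
     (map (\<lambda>i. xs ! (2 * i)) [0..<(length xs + 1) div 2],
      map (\<lambda>i. xs ! (2 * i + 1)) [0..<length xs div 2])"

text \<open>The conditions correspond one by one: covering all values to being a permutation, the
  bounds to the Dumont inequalities, monotonicity to avoiding 321. The last equivalence is proved
  under the first two conditions, which make weak excedances and deficiencies increase.\<close>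

lemma odd_even_entries_in_ballot_pairs_iff:
  "odd_even_entries xs \<in> ballot_pairs ((length xs + 1) div 2) (length xs div 2) \<longleftrightarrow>
    xs \<in> permutations_of_set {1..length xs} \<and> dumont_second xs \<and> avoids xs [3, 2, 1]"
proof -
  let ?n = "length xs"
  let ?a = "(?n + 1) div 2" and ?b = "?n div 2"
  let ?u = "map (\<lambda>i. xs ! (2 * i)) [0..<?a]" and ?v = "map (\<lambda>i. xs ! (2 * i + 1)) [0..<?b]"
  have ab: "?a + ?b = ?n" by presburger
  have lt_a: "i < ?a \<longleftrightarrow> 2 * i < ?n" for i by presburger
  have lt_b: "i < ?b \<longleftrightarrow> 2 * i + 1 < ?n" for i by presburger
  have set_eq: "set ?u \<union> set ?v = set xs"
  proof (intro set_eqI iffI)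
    fix x assume "x \<in> set ?u \<union> set ?v"
    then show "x \<in> set xs" using lt_a lt_b by auto
  next
    fix x assume "x \<in> set xs"
    then obtain i where i: "i < ?n" "x = xs ! i" by (metis in_set_conv_nth)
    show "x \<in> set ?u \<union> set ?v"
    proof (cases "even i")
      case True
      then obtain l where "i = 2 * l" by (elim evenE)
      then show ?thesis using i lt_a[of l] by auto
    next
      case False
      then obtain l where "i = 2 * l + 1" by (elim oddE)
      then show ?thesis using i lt_b[of l] by auto
    qed
  qed
  have perm: "xs \<in> permutations_of_set {1..?n} \<longleftrightarrow> set xs = {1..?n}"
    by (auto simp: permutations_of_set_def intro: card_distinct)
  have dumont: "dumont_second xs \<longleftrightarrow>
      (\<forall>j<?a. 2 * j + 1 \<le> ?u ! j) \<and> (\<forall>j<?b. ?v ! j \<le> 2 * j + 1)"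
  proof -
    have "(\<forall>i<?n. if even i then i < xs ! i else xs ! i \<le> i) \<longleftrightarrow>
        (\<forall>j. 2 * j < ?n \<longrightarrow> 2 * j < xs ! (2 * j)) \<and>
        (\<forall>j. 2 * j + 1 < ?n \<longrightarrow> xs ! (2 * j + 1) \<le> 2 * j + 1)"
      by (auto elim!: evenE oddE)
    then show ?thesis
      unfolding dumont_second_iff_nth by (auto simp: lt_a lt_b Suc_le_eq)
  qed
  have sorted: "sorted_wrt (<) ?u \<and> sorted_wrt (<) ?v \<longleftrightarrow>
      (\<forall>i j. i < j \<longrightarrow> j < ?n \<longrightarrow> even i = even j \<longrightarrow> xs ! i < xs ! j)"
  proof -
    have "sorted_wrt (<) ?u \<longleftrightarrow> (\<forall>i j. i < j \<longrightarrow> 2 * j < ?n \<longrightarrow> xs ! (2 * i) < xs ! (2 * j))"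
      unfolding sorted_wrt_iff_nth_less by (auto simp: lt_a)
    moreover have "sorted_wrt (<) ?v \<longleftrightarrow>
        (\<forall>i j. i < j \<longrightarrow> 2 * j + 1 < ?n \<longrightarrow> xs ! (2 * i + 1) < xs ! (2 * j + 1))"
      unfolding sorted_wrt_iff_nth_less by (auto simp: lt_b)
    moreover have "(\<forall>i j. i < j \<longrightarrow> j < ?n \<longrightarrow> even i = even j \<longrightarrow> xs ! i < xs ! j) \<longleftrightarrow>
        (\<forall>i j. i < j \<longrightarrow> 2 * j < ?n \<longrightarrow> xs ! (2 * i) < xs ! (2 * j)) \<and>
        (\<forall>i j. i < j \<longrightarrow> 2 * j + 1 < ?n \<longrightarrow> xs ! (2 * i + 1) < xs ! (2 * j + 1))"
      (is "?P \<longleftrightarrow> ?Q \<and> ?R")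
    proof
      assume ?P
      then show "?Q \<and> ?R" by simp
    next
      assume QR: "?Q \<and> ?R"
      show ?P
      proof (intro allI impI)
        fix i j assume ij: "i < j" "j < ?n" "even i = even j"
        show "xs ! i < xs ! j"
        proof (cases "even i")
          case True
          then obtain k l where "i = 2 * k" "j = 2 * l" using ij(3) by (metis evenE)
          with QR ij show ?thesis by auto
        next
          case False
          then obtain k l where "i = 2 * k + 1" "j = 2 * l + 1" using ij(3) by (metis oddE)
          with QR ij show ?thesis by auto
        qed
      qed
    qed
    ultimately show ?thesis by (simp only:)
  qed
  have "sorted_wrt (<) ?u \<and> sorted_wrt (<) ?v \<longleftrightarrow> avoids xs [3, 2, 1]"
    if "set xs = {1..?n}" "dumont_second xs"
    unfolding sorted
  proof
    assume inc: "\<forall>i j. i < j \<longrightarrow> j < ?n \<longrightarrow> even i = even j \<longrightarrow> xs ! i < xs ! j"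
    show "avoids xs [3, 2, 1]"
      unfolding avoids_321_iff_nth
    proof (intro allI impI notI)
      fix i j k assume *: "i < j" "j < k" "k < ?n" "xs ! j < xs ! i" "xs ! k < xs ! j"
      \<comment> \<open>Entries at indices of equal parity increase, so a decreasing triple would
        need three pairwise different parities.\<close>
      then have "even i \<noteq> even j" "even j \<noteq> even k" "even i \<noteq> even k"
        using inc by (metis less_asym less_trans)+
      then show False by blast
    qed
  next
    assume av: "avoids xs [3, 2, 1]"
    show "\<forall>i j. i < j \<longrightarrow> j < ?n \<longrightarrow> even i = even j \<longrightarrow> xs ! i < xs ! j"
    proof (intro allI impI)
      fix i j assume ij: "i < j" "j < ?n" "even i = even j"
      show "xs ! i < xs ! j"
      proof (cases "even i")
        case True
        then have "j < xs ! j" using that(2) ij unfolding dumont_second_iff_nth by auto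
        then show ?thesis using weak_excedances_increasing[OF that(1) av ij(1,2)] by simp
      next
        case False
        then have "xs ! i \<le> i" using that(2) ij unfolding dumont_second_iff_nth by auto
        then show ?thesis using deficiencies_increasing[OF that(1) av ij(1,2)] by simp
      qed
    qed
  qed
  then show ?thesis
    unfolding perm dumont odd_even_entries_def ballot_pairs_def mem_Collect_eq prod.case
      ab set_eq length_map length_upt diff_zero
    by blast
qed

text \<open>Interleaving inverts the separation on all lists of length \<open>n\<close>; the
  combinatorial conditions enter only through the preceding equivalence.\<close>

lemma bij_betw_odd_even_entries:
  "bij_betw odd_even_entries {xs. length xs = n}
     ({u. length u = (n + 1) div 2} \<times> {v. length v = n div 2})"
proof (rule bij_betwI[where g = "\<lambda>(u, v). map (\<lambda>i. if even i then u ! (i div 2) else v ! (i div 2)) [0..<n]"])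
  show "odd_even_entries \<in> {xs. length xs = n} \<rightarrow>
      {u. length u = (n + 1) div 2} \<times> {v. length v = n div 2}"
    by (simp add: odd_even_entries_def)
next
  fix xs :: "nat list" assume "xs \<in> {xs. length xs = n}"
  then have n: "length xs = n" by simp
  have "i div 2 < (n + 1) div 2" if "i < n" "even i" for i
    using that by presburger
  moreover have "i div 2 < n div 2" if "i < n" "odd i" for i
    using that by presburger
  ultimately show "(case odd_even_entries xs of (u, v) \<Rightarrow>
      map (\<lambda>i. if even i then u ! (i div 2) else v ! (i div 2)) [0..<n]) = xs"
    by (intro nth_equalityI) (auto simp: odd_even_entries_def n)
next
  fix w :: "nat list \<times> nat list"
  assume "w \<in> {u. length u = (n + 1) div 2} \<times> {v. length v = n div 2}"
  then obtain u v where w: "w = (u, v)" "length u = (n + 1) div 2" "length v = n div 2"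
    by auto
  have "2 * i < n" if "i < (n + 1) div 2" for i
    using that by presburger
  moreover have "Suc (2 * i) < n" if "i < n div 2" for i
    using that by presburger
  ultimately show "odd_even_entries (case w of (u, v) \<Rightarrow>
      map (\<lambda>i. if even i then u ! (i div 2) else v ! (i div 2)) [0..<n]) = w"
    using w(2,3) by (auto simp: odd_even_entries_def w(1) intro!: nth_equalityI)
qed auto

lemma card_dumont_second_avoids_321:
  "real (card {p \<in> permutations_of_set {1..n}. dumont_second p \<and> avoids p [3, 2, 1]}) =
     catalan (n div 2)"
proof -
  let ?D = "{p \<in> permutations_of_set {1..n}. dumont_second p \<and> avoids p [3, 2, 1]}"
  let ?Q = "ballot_pairs ((n + 1) div 2) (n div 2)"
  have len: "length p = n" if "p \<in> permutations_of_set {1..n}" for p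
    using length_finite_permutations_of_set[OF that] by simp
  \<comment> \<open>As the full preimage of \<open>?Q\<close> under a bijection, \<open>?D\<close>
    is itself in bijection with \<open>?Q\<close>.\<close>
  have D: "?D = {p \<in> {p. length p = n}. odd_even_entries p \<in> ?Q}"
    using len odd_even_entries_in_ballot_pairs_iff by blast
  have "bij_betw odd_even_entries ?D ?Q"
    unfolding bij_betw_def
  proof
    show "inj_on odd_even_entries ?D"
      using bij_betw_odd_even_entries[of n] unfolding D bij_betw_def by (auto intro: inj_on_subset)
    show "odd_even_entries ` ?D = ?Q"
    proof
      show "?Q \<subseteq> odd_even_entries ` ?D"
      proof
        fix w assume w: "w \<in> ?Q"
        then have "w \<in> {u. length u = (n + 1) div 2} \<times> {v. length v = n div 2}"
          by (auto simp: ballot_pairs_def)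
        then obtain p where "length p = n" "w = odd_even_entries p"
          using bij_betw_imp_surj_on[OF bij_betw_odd_even_entries[of n]] by blast
        then show "w \<in> odd_even_entries ` ?D" using w unfolding D by blast
      qed
    qed (use D in blast)
  qed
  then have "card ?D = card ?Q" by (rule bij_betw_same_card)
  also have "\<dots> = card (ballot_pairs (n div 2) (n div 2))"
  proof (cases "even n")
    case False
    then have "(n + 1) div 2 = Suc (n div 2)" by presburger
    then show ?thesis by (simp add: card_ballot_pairs_odd_diagonal)
  qed simp
  finally show ?thesis by (simp add: card_ballot_pairs_diagonal)
qed

theorem theorem4p3:
  fixes n :: nat
  shows "real (card {p \<in> permutations_of_set {1..n}. dumont_second p \<and> avoids p [3, 2, 1]})
           = catalan (n div 2) \<and>
         real (card {p \<in> permutations_of_set {1..n}. dumont_first p \<and> avoids p [2, 3, 1]})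
           = catalan (n div 2) \<and>
         real (card {p \<in> permutations_of_set {1..n}. dumont_first p \<and> avoids p [3, 1, 2]})
           = catalan (n div 2)"
  \<comment> \<open>The interval \<open>{1..<Suc n}\<close> starts at an odd value and has length
    \<open>n\<close>, so both first-kind formulas take their Catalan branch.\<close>
  using card_dumont_second_avoids_321[of n] card_parity_avoiders_231[of 1 "Suc n"]
    card_parity_avoiders_312_False[of 1 "Suc n"]
  by (simp only: dumont_first_avoiders_eq) simp

end
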